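(* Let $\rho>1/2$ and $\epsilon>0$ be real, and let $\delta_{1\rho},\delta_{2\rho}$ be real numbers satisfying $$\frac{\pi}{2\rho}<\delta_{1\rho}\le\min\left(\pi,\frac{\pi}{\rho}\right),\qquad \frac{\pi}{2\rho}<\delta_{2\rho}\le\min\left(\pi,\frac{\pi}{\rho}\right).$$ Let $\mu=\mu_R+i\mu_I$ be any complex number ($\mu_R,\mu_I\in\mathbb{R}$) and let $z=te^{i\theta}$ be any complex number with $t=|z|>0$ and $\theta\in\mathbb{R}$ satisfying $$\frac{\pi}{2\rho}-\delta_{2\rho}+\pi<\theta<-\frac{\pi}{2\rho}+\delta_{1\rho}+\pi.$$ Then the Mittag-Leffler function $E_{\rho,\mu}(z)=\sum_{k=0}^\infty \frac{z^k}{\Gamma(\mu+k/\rho)}$ can be represented in the form $$E_{\rho,\mu}(z)=\int_{1+\epsilon}^{\infty}K^{Re}_{\rho,\mu}(r,-\delta_{1\rho},\delta_{2\rho},t,\theta)\,dr+\int_{-\delta_{1\rho}-\pi}^{\delta_{2\rho}-\pi}P^{Re}_{\rho,\mu}(1+\epsilon,\varphi,t,\theta)\,d\varphi$$ $$\qquad+i\left\{\int_{1+\epsilon}^{\infty}K^{Im}_{\rho,\mu}(r,-\delta_{1\rho},\delta_{2\rho},t,\theta)\,dr+\int_{-\delta_{1\rho}-\pi}^{\delta_{2\rho}-\pi}P^{Im}_{\rho,\mu}(1+\epsilon,\varphi,t,\theta)\,d\varphi\right\},$$ where $$K^{Re}_{\rho,\mu}(r,\varphi_1,\varphi_2,t,\theta)=\frac{\rho}{2\pi}\,\frac{(tr)^{\rho(1-\mu_R)}}{(r^2+2r\cos\varphi_1+1)(r^2+2r\cos\varphi_2+1)}$$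 $$\times\Big[f(r,\varphi_2-\pi,t,\theta)(r^2+2r\cos\varphi_1+1)\big(r\sin(\xi(r,\varphi_2-\pi,t,\theta))+\sin(\xi(r,\varphi_2-\pi,t,\theta)+\varphi_2)\big)$$ $$-f(r,\varphi_1-\pi,t,\theta)(r^2+2r\cos\varphi_2+1)\big(r\sin(\xi(r,\varphi_1-\pi,t,\theta))+\sin(\xi(r,\varphi_1-\pi,t,\theta)+\varphi_1)\big)\Big],$$ $$K^{Im}_{\rho,\mu}(r,\varphi_1,\varphi_2,t,\theta)=\frac{\rho}{2\pi}\,\frac{(tr)^{\rho(1-\mu_R)}}{(r^2+2r\cos\varphi_1+1)(r^2+2r\cos\varphi_2+1)}$$ $$\times\Big[f(r,\varphi_1-\pi,t,\theta)(r^2+2r\cos\varphi_2+1)\big(r\cos(\xi(r,\varphi_1-\pi,t,\theta))+\cos(\xi(r,\varphi_1-\pi,t,\theta)+\varphi_1)\big)$$ $$-f(r,\varphi_2-\pi,t,\theta)(r^2+2r\cos\varphi_1+1)\big(r\cos(\xi(r,\varphi_2-\pi,t,\theta))+\cos(\xi(r,\varphi_2-\pi,t,\theta)+\varphi_2)\big)\Big],$$ $$P^{Re}_{\rho,\mu}(r,\varphi,t,\theta)=\frac{\rho}{2\pi}\,\frac{(tr)^{\rho(1-\mu_R)}\,r\,f(r,\varphi,t,\theta)}{r^2-2r\cos\varphi+1}\big(r\cos(\xi(r,\varphi,t,\theta))-\cos(\xi(r,\varphi,t,\theta)+\varphi)\big),$$ $$P^{Im}_{\rho,\mu}(r,\varphi,t,\theta)=\frac{\rho}{2\pi}\,\frac{(tr)^{\rho(1-\mu_R)}\,r\,f(r,\varphi,t,\theta)}{r^2-2r\cos\varphi+1}\big(r\sin(\xi(r,\varphi,t,\theta))-\sin(\xi(r,\varphi,t,\theta)+\varphi)\big),$$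 and $$f(r,\varphi,t,\theta)=\exp\{(tr)^\rho\cos(\rho(\theta+\varphi))+\rho\mu_I(\theta+\varphi)\},$$ $$\xi(r,\varphi,t,\theta)=(tr)^\rho\sin(\rho(\theta+\varphi))+\rho(1-\mu_R)(\theta+\varphi)-\rho\mu_I\ln(tr).$$
   Context: The two-parameter Mittag-Leffler function is $E_{\rho,\mu}(z)=\sum_{k=0}^{\infty}\frac{z^k}{\Gamma(\mu+k/\rho)}$ for $\rho>0$, $\mu\in\mathbb{C}$, $z\in\mathbb{C}$, where $\Gamma$ is the Gamma function and $1/\Gamma$ is understood to be $0$ at the poles of $\Gamma$. *)

theory Defs
  imports "HOL-Analysis.Analysis"
begin

(* rGamma is the entire function 1/Gamma, which vanishes at the poles of Gamma. *)
definition mittag_leffler :: "real \<Rightarrow> complex \<Rightarrow> complex \<Rightarrow> complex" where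
  "mittag_leffler \<rho> \<mu> z = (\<Sum>k. z ^ k * rGamma (\<mu> + of_nat k / of_real \<rho>))"

(* With zeta = r e^(i phi) and z = t e^(i theta), the functions below come from the contour
   integrand rho/(2 pi i) * exp((z zeta)^rho) * (z zeta)^(rho (1 - mu)) / (zeta - 1), the powers
   taken along arg(z zeta) = theta + phi:  (z zeta)^(rho (1 - mu)) * exp((z zeta)^rho) =
   (t r)^(rho (1 - Re mu)) * f * e^(i xi).  K is the contribution of the two rays
   zeta = r e^(i (phi_j - pi)), P that of the arc |zeta| = r. *)
definition f_ML :: "real \<Rightarrow> complex \<Rightarrow> real \<Rightarrow> real \<Rightarrow> real \<Rightarrow> real \<Rightarrow> real" where
  "f_ML \<rho> \<mu> r \<phi> t \<theta> =
     exp ((t * r) powr \<rho> * cos (\<rho> * (\<theta> + \<phi>)) + \<rho> * Im \<mu> * (\<theta> + \<phi>))"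

definition xi_ML :: "real \<Rightarrow> complex \<Rightarrow> real \<Rightarrow> real \<Rightarrow> real \<Rightarrow> real \<Rightarrow> real" where
  "xi_ML \<rho> \<mu> r \<phi> t \<theta> =
     (t * r) powr \<rho> * sin (\<rho> * (\<theta> + \<phi>)) + \<rho> * (1 - Re \<mu>) * (\<theta> + \<phi>)
       - \<rho> * Im \<mu> * ln (t * r)"

definition K_Re :: "real \<Rightarrow> complex \<Rightarrow> real \<Rightarrow> real \<Rightarrow> real \<Rightarrow> real \<Rightarrow> real \<Rightarrow> real" where
  "K_Re \<rho> \<mu> r \<phi>1 \<phi>2 t \<theta> =
     \<rho> / (2 * pi) *
     ((t * r) powr (\<rho> * (1 - Re \<mu>)) /
       ((r\<^sup>2 + 2 * r * cos \<phi>1 + 1) * (r\<^sup>2 + 2 * r * cos \<phi>2 + 1))) *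
     (f_ML \<rho> \<mu> r (\<phi>2 - pi) t \<theta> * (r\<^sup>2 + 2 * r * cos \<phi>1 + 1) *
        (r * sin (xi_ML \<rho> \<mu> r (\<phi>2 - pi) t \<theta>) + sin (xi_ML \<rho> \<mu> r (\<phi>2 - pi) t \<theta> + \<phi>2))
      - f_ML \<rho> \<mu> r (\<phi>1 - pi) t \<theta> * (r\<^sup>2 + 2 * r * cos \<phi>2 + 1) *
        (r * sin (xi_ML \<rho> \<mu> r (\<phi>1 - pi) t \<theta>) + sin (xi_ML \<rho> \<mu> r (\<phi>1 - pi) t \<theta> + \<phi>1)))"

definition K_Im :: "real \<Rightarrow> complex \<Rightarrow> real \<Rightarrow> real \<Rightarrow> real \<Rightarrow> real \<Rightarrow> real \<Rightarrow> real" where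
  "K_Im \<rho> \<mu> r \<phi>1 \<phi>2 t \<theta> =
     \<rho> / (2 * pi) *
     ((t * r) powr (\<rho> * (1 - Re \<mu>)) /
       ((r\<^sup>2 + 2 * r * cos \<phi>1 + 1) * (r\<^sup>2 + 2 * r * cos \<phi>2 + 1))) *
     (f_ML \<rho> \<mu> r (\<phi>1 - pi) t \<theta> * (r\<^sup>2 + 2 * r * cos \<phi>2 + 1) *
        (r * cos (xi_ML \<rho> \<mu> r (\<phi>1 - pi) t \<theta>) + cos (xi_ML \<rho> \<mu> r (\<phi>1 - pi) t \<theta> + \<phi>1))
      - f_ML \<rho> \<mu> r (\<phi>2 - pi) t \<theta> * (r\<^sup>2 + 2 * r * cos \<phi>1 + 1) *
        (r * cos (xi_ML \<rho> \<mu> r (\<phi>2 - pi) t \<theta>) + cos (xi_ML \<rho> \<mu> r (\<phi>2 - pi) t \<theta> + \<phi>2)))"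

definition P_Re :: "real \<Rightarrow> complex \<Rightarrow> real \<Rightarrow> real \<Rightarrow> real \<Rightarrow> real \<Rightarrow> real" where
  "P_Re \<rho> \<mu> r \<phi> t \<theta> =
     \<rho> / (2 * pi) *
     ((t * r) powr (\<rho> * (1 - Re \<mu>)) * r * f_ML \<rho> \<mu> r \<phi> t \<theta> / (r\<^sup>2 - 2 * r * cos \<phi> + 1)) *
     (r * cos (xi_ML \<rho> \<mu> r \<phi> t \<theta>) - cos (xi_ML \<rho> \<mu> r \<phi> t \<theta> + \<phi>))"

definition P_Im :: "real \<Rightarrow> complex \<Rightarrow> real \<Rightarrow> real \<Rightarrow> real \<Rightarrow> real \<Rightarrow> real" where
  "P_Im \<rho> \<mu> r \<phi> t \<theta> =
     \<rho> / (2 * pi) *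
     ((t * r) powr (\<rho> * (1 - Re \<mu>)) * r * f_ML \<rho> \<mu> r \<phi> t \<theta> / (r\<^sup>2 - 2 * r * cos \<phi> + 1)) *
     (r * sin (xi_ML \<rho> \<mu> r \<phi> t \<theta>) - sin (xi_ML \<rho> \<mu> r \<phi> t \<theta> + \<phi>))"

end

theory Submission
  imports Defs "HOL-Complex_Analysis.Cauchy_Integral_Theorem" "HOL-Real_Asymp.Real_Asymp"
begin

text \<open>
  Hankel's formula writes \<open>1 / \<Gamma>(s)\<close> as \<open>1/(2\<pi>\<i>) \<integral> e\<^sup>u u\<^sup>-\<^sup>s du\<close> over a contour that comes in from
  infinity along a ray in the half-plane \<open>Re u < 0\<close>, circles the origin anticlockwise and leaves
  along another such ray. With \<open>u = (z \<zeta>)\<^sup>\<rho>\<close> the \<open>k\<close>-th term of the Mittag-Leffler series becomes an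
  integral over \<open>\<zeta>\<close> in which \<open>k\<close> enters only through the factor \<open>\<zeta>\<^sup>-\<^sup>k\<close>. On the contour chosen here
  \<open>\<bar>\<zeta>\<bar> \<ge> 1 + \<epsilon> > 1\<close>, so the geometric series can be summed under the integral sign by dominated
  convergence (\<open>mittag_leffler_contour\<close>); the sum has the kernel \<open>1 / (\<zeta> - 1)\<close>, and its real and
  imaginary parts on the rays and on the arc are the functions of the statement. The hypotheses on
  \<open>\<delta>1\<close>, \<open>\<delta>2\<close> and \<open>\<theta>\<close> ensure that the rays for \<open>u\<close> lie in \<open>Re u < 0\<close>, where \<open>e\<^sup>u\<close> decays.

  Hankel's formula itself (\<open>hankel_limit\<close>) is proved in the variable \<open>w = ln u\<close>, in which the
  integrand \<open>exp (e\<^sup>w + (1 - s) w)\<close> is entire. If \<open>F\<close> is a primitive, the integral over the contour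
  with its rays cut off at \<open>Re w = x\<close> is a difference of two values of \<open>F\<close>, and the formula says that
  this difference tends to \<open>2\<pi>\<i> / \<Gamma>(s)\<close> as \<open>x \<rightarrow> \<infinity>\<close>. Deforming a contour thus amounts to
  estimating increments of \<open>F\<close> over vertical segments. For \<open>Re s < 1\<close> the limit is found from Euler's
  integral for \<open>\<Gamma>(1 - s)\<close> and the reflection formula, and the recurrence of the Gamma function extends
  it to all \<open>s\<close>.
\<close>

section \<open>Hankel's formula for the reciprocal Gamma function\<close>

text \<open>
  The integrand of Hankel's contour integral for \<open>1 / \<Gamma>(s)\<close> in the logarithmic variable \<open>w\<close>:
  with \<open>u = exp w\<close> it is \<open>e\<^sup>u u\<^sup>-\<^sup>s du/dw\<close>, the power being taken along \<open>arg u = Im w\<close>. It is entire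
  in \<open>w\<close>, so no branch cut has to be chosen.
\<close>
definition hankel_integrand :: "complex \<Rightarrow> complex \<Rightarrow> complex" where
  "hankel_integrand s w = exp (exp w + (1 - s) * w)"

lemma hankel_integrand_primitive:
  obtains F where "\<And>w. (F has_field_derivative hankel_integrand s w) (at w)"
proof -
  have "hankel_integrand s holomorphic_on UNIV"
    unfolding hankel_integrand_def by (intro holomorphic_intros)
  from holomorphic_convex_primitive'[OF convex_UNIV open_UNIV this] that show ?thesis by auto
qed

lemma norm_hankel_integrand:
  "norm (hankel_integrand s (of_real x + \<i> * of_real y))
     = exp (exp x * cos y + (1 - Re s) * x + Im s * y)"
  by (simp add: hankel_integrand_def Re_exp algebra_simps)

lemma continuous_on_hankel_integrand [continuous_intros]:
  "continuous_on A g \<Longrightarrow> continuous_on A (\<lambda>x. hankel_integrand s (g x))"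
  unfolding hankel_integrand_def by (intro continuous_intros)

text \<open>
  If an entire \<open>f\<close> decays uniformly on vertical segments that move away, then so does the
  increment over them of a primitive of \<open>f\<close>. This takes the place of closing a contour at
  infinity.
\<close>
lemma vertical_difference_tendsto_0:
  fixes F f :: "complex \<Rightarrow> complex"
  assumes F: "\<And>w. (F has_field_derivative f w) (at w)"
    and B: "\<And>x y. y \<in> closed_segment a b \<Longrightarrow> norm (f (of_real x + \<i> * of_real y)) \<le> B x"
    and lim: "(B \<longlongrightarrow> 0) G"
  shows "((\<lambda>x. F (of_real x + \<i> * of_real b) - F (of_real x + \<i> * of_real a)) \<longlongrightarrow> 0) G"
proof (rule Lim_null_comparison[OF always_eventually])
  show "\<forall>x. norm (F (of_real x + \<i> * of_real b) - F (of_real x + \<i> * of_real a)) \<le> B x * \<bar>b - a\<bar>"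
  proof
    fix x :: real
    let ?S = "closed_segment (of_real x + \<i> * of_real a) (of_real x + \<i> * of_real b) :: complex set"
    have S: "\<exists>y\<in>closed_segment a b. w = of_real x + \<i> * of_real y" if "w \<in> ?S" for w
    proof -
      from that obtain u where u: "0 \<le> u \<and> u \<le> 1 \<and>
        w = (1 - u) *\<^sub>R (of_real x + \<i> * of_real a) + u *\<^sub>R (of_real x + \<i> * of_real b)"
        unfolding in_segment ..
      then have "w = of_real x + \<i> * of_real ((1 - u) *\<^sub>R a + u *\<^sub>R b)"
        by (simp add: scaleR_conv_of_real algebra_simps)
      moreover have "(1 - u) *\<^sub>R a + u *\<^sub>R b \<in> closed_segment a b"
        unfolding in_segment using u by (intro exI[of _ u]) simp
      ultimately show ?thesis by (rule bexI)
    qed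
    have "norm (F (of_real x + \<i> * of_real b) - F (of_real x + \<i> * of_real a))
        \<le> B x * norm ((of_real x + \<i> * of_real b) - (of_real x + \<i> * of_real a) :: complex)"
    proof (rule field_differentiable_bound[OF convex_closed_segment])
      show "(F has_field_derivative f z) (at z within ?S)" for z
        using F by (rule has_field_derivative_at_within)
      show "norm (f z) \<le> B x" if "z \<in> ?S" for z
      proof -
        obtain y where "y \<in> closed_segment a b" "z = of_real x + \<i> * of_real y"
          using S[OF \<open>z \<in> ?S\<close>] ..
        then show ?thesis by (simp add: B)
      qed
    qed (rule ends_in_segment)+
    also have "(of_real x + \<i> * of_real b) - (of_real x + \<i> * of_real a) = \<i> * of_real (b - a)"
      by (simp add: algebra_simps)
    also have "norm (\<i> * of_real (b - a)) = \<bar>b - a\<bar>"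
      by (simp only: norm_mult norm_ii norm_of_real mult_1_left)
    finally show "norm (F (of_real x + \<i> * of_real b) - F (of_real x + \<i> * of_real a)) \<le> B x * \<bar>b - a\<bar>" .
  qed
  show "((\<lambda>x. B x * \<bar>b - a\<bar>) \<longlongrightarrow> 0) G"
    using tendsto_mult_right[OF lim, of "\<bar>b - a\<bar>"] by simp
qed

lemma cos_closed_segment_neg:
  fixes a b :: real
  assumes "\<And>y. y \<in> closed_segment a b \<Longrightarrow> cos y < 0"
  obtains c where "c > 0" "\<And>y. y \<in> closed_segment a b \<Longrightarrow> cos y \<le> - c"
proof -
  have "\<exists>u\<in>closed_segment a b. \<forall>y\<in>closed_segment a b. cos y \<le> cos u"
    by (rule continuous_attains_sup) (auto intro!: continuous_intros)
  then obtain u where "u \<in> closed_segment a b" "\<forall>y\<in>closed_segment a b. cos y \<le> cos u" ..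
  with assms[of u] that[of "- cos u"] show ?thesis by auto
qed

lemma cos_neg_left_half_plane:
  assumes "pi / 2 < y" "y < 3 * pi / 2"
  shows "cos y < 0"
  using cos_gt_zero_pi[of "y - pi"] assms by (simp add: cos_diff)

lemma hankel_integrand_le:
  assumes "cos y \<le> c" and "\<bar>y\<bar> \<le> M"
  shows "norm (hankel_integrand s (of_real x + \<i> * of_real y))
     \<le> exp (c * exp x + (1 - Re s) * x + \<bar>Im s\<bar> * M)"
proof -
  have "exp x * cos y \<le> c * exp x" using assms by (simp add: mult.commute)
  moreover have "Im s * y \<le> \<bar>Im s\<bar> * M"
    by (rule order_trans[OF abs_ge_self]) (simp add: abs_mult mult_left_mono assms)
  ultimately show ?thesis
    unfolding norm_hankel_integrand exp_le_cancel_iff by linarith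
qed

lemma abs_le_closed_segment:
  "y \<in> closed_segment a b \<Longrightarrow> \<bar>y\<bar> \<le> \<bar>a\<bar> + \<bar>b\<bar>" for y :: real
  by (auto simp: closed_segment_eq_real_ivl split: if_splits)

text \<open>
  The direction in which the Hankel contour leaves may be changed as long as it stays inside the
  half-plane \<open>Re u < 0\<close>, where \<open>e\<^sup>u\<close> decays.
\<close>
lemma hankel_rays_equivalent:
  assumes F: "\<And>w. (F has_field_derivative hankel_integrand s w) (at w)"
    and "\<And>y. y \<in> closed_segment a b \<Longrightarrow> cos y < 0"
  shows "((\<lambda>x. F (of_real x + \<i> * of_real b) - F (of_real x + \<i> * of_real a)) \<longlongrightarrow> 0) at_top"
proof -
  obtain c where c: "c > 0" "\<And>y. y \<in> closed_segment a b \<Longrightarrow> cos y \<le> - c"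
    using cos_closed_segment_neg[OF assms(2)] by blast
  show ?thesis
  proof (rule vertical_difference_tendsto_0[OF F])
    show "norm (hankel_integrand s (of_real x + \<i> * of_real y))
      \<le> exp (- c * exp x + (1 - Re s) * x + \<bar>Im s\<bar> * (\<bar>a\<bar> + \<bar>b\<bar>))"
      if "y \<in> closed_segment a b" for x y
      using hankel_integrand_le[OF c(2) abs_le_closed_segment] that by blast
    show "((\<lambda>x. exp (- c * exp x + (1 - Re s) * x + \<bar>Im s\<bar> * (\<bar>a\<bar> + \<bar>b\<bar>))) \<longlongrightarrow> 0) at_top"
      using c(1) by real_asymp
  qed
qed

text \<open>
  For \<open>Re s < 1\<close> the integrand vanishes as \<open>Re w \<rightarrow> -\<infinity>\<close>, so that the circular part of the contour
  can be shrunk to the origin.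
\<close>
lemma hankel_left_end:
  assumes F: "\<And>w. (F has_field_derivative hankel_integrand s w) (at w)" and "Re s < 1"
  shows "((\<lambda>x. F (of_real x + \<i> * of_real b) - F (of_real x + \<i> * of_real a)) \<longlongrightarrow> 0) at_bot"
proof (rule vertical_difference_tendsto_0[OF F])
  show "norm (hankel_integrand s (of_real x + \<i> * of_real y))
      \<le> exp (1 * exp x + (1 - Re s) * x + \<bar>Im s\<bar> * (\<bar>a\<bar> + \<bar>b\<bar>))"
    if "y \<in> closed_segment a b" for x y
    using hankel_integrand_le[of y 1, OF _ abs_le_closed_segment] that by auto
  show "((\<lambda>x. exp (1 * exp x + (1 - Re s) * x + \<bar>Im s\<bar> * (\<bar>a\<bar> + \<bar>b\<bar>))) \<longlongrightarrow> 0) at_bot"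
    using assms(2) by real_asymp
qed

lemma has_field_derivative_along:
  fixes F :: "complex \<Rightarrow> complex"
  assumes "(F has_field_derivative d) (at (w x))" and "(w has_vector_derivative w') (at x within A)"
  shows "((\<lambda>x. F (w x)) has_vector_derivative d * w') (at x within A)"
  using field_vector_diff_chain_within[OF assms(2), of F d] assms(1)
  by (auto simp: o_def mult.commute intro: has_field_derivative_at_within)

lemma has_integral_Ici_tendsto:
  fixes f :: "real \<Rightarrow> 'a::euclidean_space"
  assumes "(f has_integral I) {a..}"
  shows "((\<lambda>x. integral {a..x} f) \<longlongrightarrow> I) at_top"
proof (rule tendstoI)
  fix e :: real assume "e > 0"
  then obtain B where B: "\<And>c d. ball 0 B \<subseteq> cbox c d \<Longrightarrow>
      norm (integral (cbox c d) (\<lambda>x. if x \<in> {a..} then f x else 0) - I) < e"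
    using assms[unfolded has_integral_alt'] by blast
  have "dist (integral {a..x} f) I < e" if "x \<ge> max \<bar>a\<bar> \<bar>B\<bar>" for x
  proof -
    have "ball 0 B \<subseteq> cbox (- x) x" using that by (auto simp: dist_norm)
    from B[OF this] have "norm (integral ({a..} \<inter> cbox (- x) x) f - I) < e"
      by (simp only: integral_restrict_Int)
    moreover have "{a..} \<inter> cbox (- x) x = {a..x}" using that by auto
    ultimately show ?thesis by (metis dist_norm)
  qed
  then show "\<forall>\<^sub>F x in at_top. dist (integral {a..x} f) I < e"
    by (meson eventually_at_top_linorderI)
qed

text \<open>
  With the rays at the angles \<open>\<plusminus>\<pi>\<close> and the circle shrunk to a point, Hankel's integral becomes
  \<open>2\<i> sin(\<pi>s)\<close> times Euler's integral for \<open>\<Gamma>(1 - s)\<close>, and the reflection formula applies.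
\<close>
lemma hankel_limit_Re_less_1:
  assumes F: "\<And>w. (F has_field_derivative hankel_integrand s w) (at w)" and s: "Re s < 1"
  shows "((\<lambda>x. F (of_real x + \<i> * of_real pi) - F (of_real x + \<i> * of_real (- pi)))
            \<longlongrightarrow> 2 * of_real pi * \<i> * rGamma s) at_top"
proof -
  define E where "E x = F (of_real x + \<i> * of_real pi) - F (of_real x + \<i> * of_real (- pi))" for x :: real
  \<comment> \<open>\<open>\<tau> = - u\<close> is the variable of Euler's integral; \<open>D\<close> is an antiderivative of its integrand \<open>f\<close>.\<close>
  define D where "D \<tau> = (if \<tau> = 0 then 0 else E (ln \<tau>))" for \<tau> :: real
  define f where "f \<tau> = of_real \<tau> powr ((1 - s) - 1) / of_real (exp \<tau>) * (2 * \<i> * sin (of_real pi * s))"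
    for \<tau> :: real
  have deriv_E: "(E has_vector_derivative
        hankel_integrand s (of_real x + \<i> * of_real pi) - hankel_integrand s (of_real x + \<i> * of_real (- pi)))
        (at x)" for x
  proof -
    have "((\<lambda>x. of_real x + \<i> * of_real b) has_vector_derivative 1) (at x)" for b
      by (auto intro!: derivative_eq_intros has_vector_derivative_of_real)
    from has_vector_derivative_diff[OF has_field_derivative_along[OF F this] has_field_derivative_along[OF F this]]
    show ?thesis unfolding E_def[abs_def] mult_1_right .
  qed
  have hankel_pi: "hankel_integrand s (of_real x + \<i> * of_real pi)
       - hankel_integrand s (of_real x + \<i> * of_real (- pi)) = of_real (exp x) * f (exp x)" for x
  proof -
    have "exp (\<i> * pi * (1 - s)) - exp (- (\<i> * pi * (1 - s))) = 2 * \<i> * sin (of_real pi * s)"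
    proof -
      have "exp (\<i> * pi * (1 - s)) = - exp (- (\<i> * pi * s))"
        by (simp add: algebra_simps exp_diff exp_minus divide_inverse)
      moreover have "exp (- (\<i> * pi * (1 - s))) = - exp (\<i> * pi * s)"
        by (simp add: algebra_simps exp_diff exp_minus divide_inverse)
      ultimately show ?thesis
        by (simp add: sin_exp_eq mult_ac)
    qed
    note c = this
    have "hankel_integrand s (of_real x + \<i> * of_real pi) 
        = exp (- exp (of_real x)) * exp ((1 - s) * of_real x) * exp (\<i> * pi * (1 - s))"
      by (simp add: hankel_integrand_def exp_add [symmetric] algebra_simps)
         (simp add: exp_add exp_diff algebra_simps)
    moreover have "hankel_integrand s (of_real x + \<i> * of_real (- pi)) 
        = exp (- exp (of_real x)) * exp ((1 - s) * of_real x) * exp (- (\<i> * pi * (1 - s)))"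
      by (simp add: hankel_integrand_def exp_add [symmetric] algebra_simps)
         (simp add: exp_add exp_diff exp_minus algebra_simps)
    ultimately have "hankel_integrand s (of_real x + \<i> * of_real pi)
       - hankel_integrand s (of_real x + \<i> * of_real (- pi))
       = exp (- exp (of_real x)) * exp ((1 - s) * of_real x) * (2 * \<i> * sin (of_real pi * s))"
      unfolding c [symmetric] by (simp add: algebra_simps)
    also have "exp (- exp (of_real x)) * exp ((1 - s) * of_real x) * (2 * \<i> * sin (of_real pi * s))
       = of_real (exp x) * f (exp x)"
      by (simp add: f_def powr_def Ln_of_real exp_minus exp_of_real[symmetric] algebra_simps exp_diff divide_inverse)
    finally show ?thesis .
  qed
  have deriv_D: "(D has_vector_derivative f \<tau>) (at \<tau>)" if "\<tau> > 0" for \<tau>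
  proof -
    have "((E \<circ> ln) has_vector_derivative (1 / \<tau>) *\<^sub>R (of_real (exp (ln \<tau>)) * f (exp (ln \<tau>)))) (at \<tau>)"
      using that deriv_E[of "ln \<tau>", unfolded hankel_pi]
      by (intro vector_diff_chain_at)
         (auto intro!: derivative_eq_intros simp: has_real_derivative_iff_has_vector_derivative[symmetric])
    then have "((E \<circ> ln) has_vector_derivative f \<tau>) (at \<tau>)"
      using that by (simp add: scaleR_conv_of_real)
    then show ?thesis
      by (rule has_vector_derivative_transform_within_open[of _ _ _ "{0<..}"])
         (use that in \<open>auto simp: D_def\<close>)
  qed
  have "((\<lambda>x. E x) \<longlongrightarrow> 0) at_bot"
    unfolding E_def by (rule hankel_left_end[OF F s])
  then have "((\<lambda>\<tau>. E (ln \<tau>)) \<longlongrightarrow> 0) (at_right 0)"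
    by (rule filterlim_compose[OF _ ln_at_0])
  then have lim0: "(D \<longlongrightarrow> D 0) (at_right 0)"
    by (auto elim!: Lim_transform_eventually simp: D_def eventually_at_filter)
  have int_D: "(f has_integral D T) {0..T}" if "T \<ge> 0" for T
  proof -
    have "continuous_on {0..T} D"
      unfolding continuous_on_eq_continuous_within
    proof
      fix x assume "x \<in> {0..T}"
      then consider "x = 0" | "x > 0" by force
      then show "continuous (at x within {0..T}) D"
      proof cases
        case 1
        have "at 0 within {0..T} \<le> at_right 0"
          unfolding at_within_def by (intro inf_mono) auto
        then show ?thesis
          unfolding 1 continuous_within using lim0 by (rule tendsto_mono)
      next
        case 2
        show ?thesis
          by (rule continuous_at_imp_continuous_at_within[OF
                has_vector_derivative_continuous[OF deriv_D[OF 2]]])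
      qed
    qed
    from fundamental_theorem_of_calculus_interior[OF that this, of f] deriv_D
    show ?thesis by (simp add: D_def)
  qed
  have "(f has_integral Gamma (1 - s) * (2 * \<i> * sin (of_real pi * s))) {0..}"
    unfolding f_def by (intro has_integral_mult_left Gamma_integral_complex) (use s in auto)
  also have "Gamma (1 - s) * (2 * \<i> * sin (of_real pi * s)) = 2 * of_real pi * \<i> * rGamma s"
  proof -
    have "1 - s \<notin> \<int>\<^sub>\<le>\<^sub>0"
      using s by (auto elim!: nonpos_Ints_cases simp: complex_eq_iff)
    then have "Gamma (1 - s) * rGamma (1 - s) = 1"
      by (simp add: Gamma_def rGamma_eq_zero_iff)
    moreover have "sin (of_real pi * s) = of_real pi * (rGamma s * rGamma (1 - s))"
      using rGamma_reflection_complex[of s] by simp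
    ultimately show ?thesis by (simp add: algebra_simps)
  qed
  finally have "((\<lambda>T. integral {0..T} f) \<longlongrightarrow> 2 * of_real pi * \<i> * rGamma s) at_top"
    by (rule has_integral_Ici_tendsto)
  then have "((\<lambda>x. integral {0..exp x} f) \<longlongrightarrow> 2 * of_real pi * \<i> * rGamma s) at_top"
    by (rule filterlim_compose) (rule exp_at_top)
  moreover have "integral {0..exp x} f = E x" for x
    using integral_unique[OF int_D[of "exp x"]] by (simp add: D_def)
  ultimately show ?thesis by (simp add: E_def)
qed

lemma norm_exp_minus_1_le: "norm (exp z - 1) \<le> exp (norm z) * norm z" for z :: complex
proof -
  have "norm (exp z - exp 0) \<le> exp (norm z) * norm (z - 0)"
  proof (rule field_differentiable_bound[of "closed_segment 0 z" exp exp])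
    show "norm (exp w) \<le> exp (norm z)" if "w \<in> closed_segment 0 z" for w
      using segment_bound(1)[OF that] norm_exp[of w] by (simp add: order_trans)
  qed (auto intro: DERIV_exp[THEN has_field_derivative_at_within])
  then show ?thesis by simp
qed

text \<open>
  The restriction on \<open>Re s\<close> is removed by the recurrence \<open>s / \<Gamma>(s + 1) = 1 / \<Gamma>(s)\<close>, which for the
  contour integrals is an integration by parts. It gives nothing when passing from \<open>0\<close> to \<open>1\<close>; at
  \<open>s = 1\<close> the integrand has period \<open>2\<pi>\<i>\<close>, the two rays cancel and the circle contributes \<open>2\<pi>\<i>\<close>.
\<close>
lemma hankel_limit_pi:
  assumes F: "\<And>w. (F has_field_derivative hankel_integrand s w) (at w)" and n: "Re s < 1 + real n"
  shows "((\<lambda>x. F (of_real x + \<i> * of_real pi) - F (of_real x + \<i> * of_real (- pi)))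
            \<longlongrightarrow> 2 * of_real pi * \<i> * rGamma s) at_top"
  using assms
proof (induction n arbitrary: s F)
  case 0
  then show ?case using hankel_limit_Re_less_1[of F s] by simp
next
  case (Suc n)
  note F = Suc.prems(1)
  show ?case
  proof (cases "s = 1")
    case False
    define u where "u = s - 1"
    obtain G where G: "\<And>w. (G has_field_derivative hankel_integrand u w) (at w)"
      using hankel_integrand_primitive by blast
    have lim_G: "((\<lambda>x. G (of_real x + \<i> * of_real pi) - G (of_real x + \<i> * of_real (- pi)))
            \<longlongrightarrow> 2 * of_real pi * \<i> * rGamma u) at_top"
      using Suc.IH[OF G] Suc.prems(2) by (simp add: u_def)
    \<comment> \<open>The boundary term of the integration by parts: \<open>h' = G' - u F'\<close>.\<close>
    define h where "h w = exp (exp w - u * w)" for w :: complex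
    have g_u: "hankel_integrand u w = exp w * exp (exp w - u * w)" for w
      by (simp add: hankel_integrand_def exp_add[symmetric] algebra_simps)
    have g_s: "hankel_integrand s w = exp (exp w - u * w)" for w
      by (simp add: hankel_integrand_def u_def algebra_simps)
    have "((\<lambda>w. G w - u * F w - h w) has_field_derivative 0) (at w)" for w
      unfolding h_def
      by (rule derivative_eq_intros G F refl | simp)+
         (simp add: g_u g_s algebra_simps)
    then obtain C where C: "\<And>w. G w - u * F w - h w = C"
      using has_field_derivative_zero_constant[of UNIV "\<lambda>w. G w - u * F w - h w"] by auto
    have h_lim: "((\<lambda>x. h (of_real x + \<i> * of_real b)) \<longlongrightarrow> 0) at_top" if "cos b = -1" for b
    proof (rule Lim_null_comparison[OF always_eventually])
      show "\<forall>x. norm (h (of_real x + \<i> * of_real b)) \<le> exp (- exp x - Re u * x + Im u * b)"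
        by (simp add: h_def Re_exp that)
      show "((\<lambda>x. exp (- exp x - Re u * x + Im u * b)) \<longlongrightarrow> 0) at_top"
        by real_asymp
    qed
    have "((\<lambda>x. ((G (of_real x + \<i> * of_real pi) - G (of_real x + \<i> * of_real (- pi)))
              - (h (of_real x + \<i> * of_real pi) - h (of_real x + \<i> * of_real (- pi)))) / u)
            \<longlongrightarrow> (2 * of_real pi * \<i> * rGamma u - (0 - 0)) / u) at_top"
      by (intro tendsto_intros lim_G h_lim) (use False in \<open>auto simp: u_def\<close>)
    moreover have "F w - F w' = ((G w - G w') - (h w - h w')) / u" for w w'
    proof -
      have "u * (F w - F w') = (G w - G w') - (h w - h w')"
        using C[of w] C[of w'] by (simp add: algebra_simps)
      then show ?thesis using False by (simp add: u_def eq_divide_eq mult.commute)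
    qed
    moreover have "rGamma u / u = rGamma s"
      using rGamma_plus1[of u] False by (simp add: u_def field_simps)
    ultimately show ?thesis by (simp only: diff_0_right times_divide_eq_right[symmetric])
  next
    case True
    define d where "d x = F (of_real x + \<i> * of_real pi) - F (of_real x + \<i> * of_real (- pi))" for x :: real
    have per: "F (w + 2 * of_real pi * \<i>) - F w = F (w' + 2 * of_real pi * \<i>) - F w'" for w w'
    proof -
      have "((\<lambda>w. F (w + 2 * of_real pi * \<i>) - F w) has_field_derivative
             (hankel_integrand s (v + 2 * of_real pi * \<i>) * 1 - hankel_integrand s v)) (at v)" for v
        by (intro DERIV_diff F DERIV_chain2[OF F]) (auto intro!: derivative_eq_intros)
      moreover have "hankel_integrand s (v + 2 * of_real pi * \<i>) = hankel_integrand s v" for v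
        by (simp add: hankel_integrand_def True exp_add mult.commute[of _ "\<i>"])
           (simp add: mult_ac)
      ultimately have "((\<lambda>w. F (w + 2 * of_real pi * \<i>) - F w) has_field_derivative 0) (at v)" for v
        by simp
      then show ?thesis
        using has_field_derivative_zero_constant[of UNIV "\<lambda>w. F (w + 2 * of_real pi * \<i>) - F w"]
        by auto
    qed
    have d_const: "d x = d 0" for x
      using per[of "of_real x + \<i> * of_real (- pi)" "of_real 0 + \<i> * of_real (- pi)"]
      by (simp add: d_def algebra_simps)
    \<comment> \<open>Towards \<open>Re w = -\<infinity>\<close> the integrand tends to \<open>1\<close>, so \<open>F w - w\<close> has vanishing increments.\<close>
    have "((\<lambda>x. (F (of_real x + \<i> * of_real pi) - (of_real x + \<i> * of_real pi))
         - (F (of_real x + \<i> * of_real (- pi)) - (of_real x + \<i> * of_real (- pi)))) \<longlongrightarrow> 0) at_bot"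
    proof (rule vertical_difference_tendsto_0)
      show "((\<lambda>w. F w - w) has_field_derivative hankel_integrand s w - 1) (at w)" for w
        by (intro derivative_intros F)
      show "norm (hankel_integrand s (of_real x + \<i> * of_real y) - 1) \<le> exp (exp x) * exp x"
        for x y :: real
      proof -
        have "hankel_integrand s (of_real x + \<i> * of_real y) = exp (exp (of_real x + \<i> * of_real y))"
          by (simp add: hankel_integrand_def True)
        then show ?thesis
          using norm_exp_minus_1_le[of "exp (of_real x + \<i> * of_real y)"] by simp
      qed
      show "((\<lambda>x. exp (exp x) * exp x) \<longlongrightarrow> (0::real)) at_bot" by real_asymp
    qed
    then have "((\<lambda>x. d x - 2 * of_real pi * \<i>) \<longlongrightarrow> 0) at_bot"
      by (simp add: d_def algebra_simps)
    moreover have "(\<lambda>x. d x - 2 * of_real pi * \<i>) = (\<lambda>x. d 0 - 2 * of_real pi * \<i>)"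
      by (intro ext arg_cong[where f = "\<lambda>c. c - _"] d_const)
    ultimately have "d 0 = 2 * of_real pi * \<i>"
      by (simp add: tendsto_const_iff)
    then have "d x = 2 * of_real pi * \<i> * rGamma s" for x
      using d_const[of x] True by simp
    then show ?thesis by (simp add: d_def)
  qed
qed

text \<open>
  Hankel's formula. Since \<open>F\<close> is a primitive, the difference is the integral of the integrand from
  \<open>x + \<i>a\<close> to \<open>x + \<i>b\<close> along any path, in particular along the truncated Hankel contour.
\<close>
theorem hankel_limit:
  assumes F: "\<And>w. (F has_field_derivative hankel_integrand s w) (at w)"
    and "- (3 * pi / 2) < a" "a < - (pi / 2)" "pi / 2 < b" "b < 3 * pi / 2"
  shows "((\<lambda>x. F (of_real x + \<i> * of_real b) - F (of_real x + \<i> * of_real a))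
            \<longlongrightarrow> 2 * of_real pi * \<i> * rGamma s) at_top"
proof -
  have b: "((\<lambda>x. F (of_real x + \<i> * of_real b) - F (of_real x + \<i> * of_real pi)) \<longlongrightarrow> 0) at_top"
    by (rule hankel_rays_equivalent[OF F], rule cos_neg_left_half_plane)
       (use assms pi_gt_zero in \<open>auto simp: closed_segment_eq_real_ivl split: if_splits\<close>)
  have "cos y < 0" if "y \<in> closed_segment a (- pi)" for y
    using cos_neg_left_half_plane[of "- y"] that assms by (auto simp: closed_segment_eq_real_ivl split: if_splits)
  then have a: "((\<lambda>x. F (of_real x + \<i> * of_real (- pi)) - F (of_real x + \<i> * of_real a)) \<longlongrightarrow> 0) at_top"
    by (rule hankel_rays_equivalent[OF F])
  obtain n :: nat where "Re s < real n" using reals_Archimedean2 by blast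
  then have "Re s < 1 + real n" by simp
  from tendsto_add[OF tendsto_add[OF b hankel_limit_pi[OF F this]] a] show ?thesis by simp
qed

section \<open>Improper integrals and geometric series\<close>

lemma has_integral_improper:
  fixes f F :: "real \<Rightarrow> 'a::euclidean_space"
  assumes F: "\<And>x. x \<ge> a \<Longrightarrow> (F has_vector_derivative f x) (at x)"
    and le: "\<And>x. x \<ge> a \<Longrightarrow> norm (f x) \<le> h x" and h: "h integrable_on {a..}"
    and lim: "(F \<longlongrightarrow> L) at_top"
  shows "(f has_integral (L - F a)) {a..}"
proof (rule has_integral_dominated_convergence[OF _ h])
  have "(f has_integral (F (a + real k) - F a)) {a..a + real k}" for k
    by (rule fundamental_theorem_of_calculus) (auto intro!: has_vector_derivative_at_within F)
  then show "((\<lambda>x. if x \<in> {a..a + real k} then f x else 0) has_integral (F (a + real k) - F a)) {a..}" for k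
    by (subst has_integral_restrict) auto
  show "\<forall>x\<in>{a..}. norm (if x \<in> {a..a + real k} then f x else 0) \<le> h x" for k
    using le by (force intro: order_trans[OF norm_ge_zero])
  show "\<forall>x\<in>{a..}. (\<lambda>k. if x \<in> {a..a + real k} then f x else 0) \<longlonglongrightarrow> f x"
  proof
    fix x assume "x \<in> {a..}"
    have "\<forall>\<^sub>F k in sequentially. x - a \<le> real k"
      using filterlim_real_sequentially by (simp add: filterlim_at_top)
    then show "(\<lambda>k. if x \<in> {a..a + real k} then f x else 0) \<longlonglongrightarrow> f x"
      by (rule tendsto_eventually[OF eventually_mono]) (use \<open>x \<in> {a..}\<close> in auto)
  qed
  have "filterlim (\<lambda>k. a + real k) at_top sequentially" by real_asymp
  then have "(\<lambda>k. F (a + real k)) \<longlonglongrightarrow> L" by (rule filterlim_compose[OF lim])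
  then show "(\<lambda>k. F (a + real k) - F a) \<longlonglongrightarrow> L - F a" by (intro tendsto_intros)
qed

lemma continuous_tendsto_0_bounded:
  fixes g :: "real \<Rightarrow> real"
  assumes "continuous_on {a..} g" and "(g \<longlongrightarrow> 0) at_top"
  obtains C where "\<And>x. x \<ge> a \<Longrightarrow> g x \<le> C"
proof -
  have "\<forall>\<^sub>F x in at_top. g x < 1" using assms(2) by (rule order_tendstoD) simp
  then obtain N where N: "\<And>x. x \<ge> N \<Longrightarrow> g x < 1" by (auto simp: eventually_at_top_linorder)
  have "compact (g ` {a..N})"
    by (intro compact_continuous_image continuous_on_subset[OF assms(1)]) auto
  then have "bdd_above (g ` {a..N})" by (intro bounded_imp_bdd_above compact_imp_bounded)
  then obtain M where M: "\<And>x. x \<in> {a..N} \<Longrightarrow> g x \<le> M" unfolding bdd_above.unfold by force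
  have "g x \<le> max M 1" if "x \<ge> a" for x
    using M[of x] N[of x] that by (cases "x \<le> N") auto
  then show ?thesis by (rule that)
qed

lemma norm_geometric_partial_sum_le:
  fixes u :: "'a::real_normed_div_algebra"
  assumes "norm u \<le> \<eta>" and "\<eta> < 1"
  shows "norm (\<Sum>k<N. u ^ k) \<le> 1 / (1 - \<eta>)"
proof -
  have "0 \<le> \<eta>" using assms(1) norm_ge_zero order_trans by blast
  then have \<eta>: "norm \<eta> < 1" using assms by simp
  have "norm (\<Sum>k<N. u ^ k) \<le> (\<Sum>k<N. \<eta> ^ k)"
    by (rule sum_norm_le) (simp add: norm_power power_mono assms)
  also have "\<dots> \<le> (\<Sum>k. \<eta> ^ k)"
    using \<open>0 \<le> \<eta>\<close> by (intro sum_le_suminf summable_geometric \<eta>) auto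
  also have "\<dots> = 1 / (1 - \<eta>)" by (rule suminf_geometric[OF \<eta>])
  finally show ?thesis .
qed

text \<open>
  Two geometric series are summed under one integral sign. They are kept together because for the
  two rays of the contour only the integral of the sum of the terms is known, not each separately.
\<close>
lemma geometric_series_integral:
  fixes q1 q2 u1 u2 :: "real \<Rightarrow> complex"
  assumes c: "\<And>k. ((\<lambda>x. q1 x * u1 x ^ k + q2 x * u2 x ^ k) has_integral c k) S"
    and u1: "\<And>x. x \<in> S \<Longrightarrow> norm (u1 x) \<le> \<eta>" and u2: "\<And>x. x \<in> S \<Longrightarrow> norm (u2 x) \<le> \<eta>"
    and \<eta>: "\<eta> < 1"
    and h: "h integrable_on S" and q: "\<And>x. x \<in> S \<Longrightarrow> norm (q1 x) + norm (q2 x) \<le> h x"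
  defines "Q \<equiv> \<lambda>x. q1 x / (1 - u1 x) + q2 x / (1 - u2 x)"
  shows "Q integrable_on S" and "c sums integral S Q"
proof -
  define f where "f N x = q1 x * (\<Sum>k<N. u1 x ^ k) + q2 x * (\<Sum>k<N. u2 x ^ k)" for N x
  have f: "(f N has_integral (\<Sum>k<N. c k)) S" for N
    using has_integral_sum[OF finite_lessThan, of N "\<lambda>k x. q1 x * u1 x ^ k + q2 x * u2 x ^ k" c S] c
    by (simp add: f_def[abs_def] sum.distrib sum_distrib_left)
  have le: "norm (f N x) \<le> h x * (1 / (1 - \<eta>))" if "x \<in> S" for N x
  proof -
    have "norm (f N x) \<le> norm (q1 x) * norm (\<Sum>k<N. u1 x ^ k) + norm (q2 x) * norm (\<Sum>k<N. u2 x ^ k)"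
      unfolding f_def norm_mult[symmetric] by (rule norm_triangle_ineq)
    also have "\<dots> \<le> norm (q1 x) * (1 / (1 - \<eta>)) + norm (q2 x) * (1 / (1 - \<eta>))"
      by (intro add_mono mult_left_mono norm_geometric_partial_sum_le u1 u2 that \<eta>) auto
    also have "\<dots> \<le> h x * (1 / (1 - \<eta>))"
      unfolding distrib_right[symmetric] using \<eta> by (intro mult_right_mono q that) auto
    finally show ?thesis .
  qed
  have lim: "(\<lambda>N. f N x) \<longlonglongrightarrow> Q x" if "x \<in> S" for x
  proof -
    have "norm (u1 x) < 1" "norm (u2 x) < 1" using u1 u2 that \<eta> by (auto intro: le_less_trans)
    from geometric_sums[OF this(1)] geometric_sums[OF this(2)] show ?thesis
      unfolding sums_def f_def Q_def
      by (auto intro!: tendsto_eq_intros simp: divide_inverse)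
  qed
  have h': "(\<lambda>x. h x * (1 / (1 - \<eta>))) integrable_on S" using h by (rule integrable_on_mult_left)
  note dc = dominated_convergence[of f S "\<lambda>x. h x * (1 / (1 - \<eta>))" Q, OF _ h' le lim]
  have "(\<lambda>N. integral S (f N)) = (\<lambda>N. \<Sum>k<N. c k)" using integral_unique[OF f] by auto
  then show "Q integrable_on S" "c sums integral S Q"
    using dc has_integral_integrable[OF f] by (auto simp: sums_def)
qed

lemma hankel_ray_decay:
  assumes "\<rho> > 0" "t > 0" "R > 0" "cos (\<rho> * \<beta>) < 0"
  obtains C where "\<And>r. r \<ge> R \<Longrightarrow>
    norm (hankel_integrand \<mu> (of_real (\<rho> * ln (t * r)) + \<i> * of_real (\<rho> * \<beta>)) * (\<rho> / r)) \<le> C * r powr (-2)"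
proof -
  define c where "c = - cos (\<rho> * \<beta>)"
  define p where "p = 1 - Re \<mu>"
  define d where "d = Im \<mu> * (\<rho> * \<beta>)"
  define g where "g r = exp (- c * exp (\<rho> * ln (t * r)) + p * (\<rho> * ln (t * r)) + d) * (\<rho> / r) * r powr 2" for r
  have "c > 0" using assms by (simp add: c_def)
  have "continuous_on {R..} g"
    unfolding g_def using assms by (intro continuous_intros) auto
  moreover have "(g \<longlongrightarrow> 0) at_top"
    unfolding g_def using assms(1,2) \<open>c > 0\<close> by real_asymp
  ultimately obtain C where C: "\<And>r. r \<ge> R \<Longrightarrow> g r \<le> C"
    by (rule continuous_tendsto_0_bounded) blast
  show ?thesis
  proof (rule that)
    fix r assume r: "r \<ge> R"
    then have "norm (hankel_integrand \<mu> (of_real (\<rho> * ln (t * r)) + \<i> * of_real (\<rho> * \<beta>)) * (\<rho> / r)) = g r * r powr (-2)"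
      using assms by (simp only: norm_mult norm_hankel_integrand)
        (simp add: g_def c_def p_def d_def norm_divide powr_minus field_simps)
    also have "\<dots> \<le> C * r powr (-2)" using C[OF r] by (rule mult_right_mono) simp
    finally show "norm (hankel_integrand \<mu> (of_real (\<rho> * ln (t * r)) + \<i> * of_real (\<rho> * \<beta>)) * (\<rho> / r))
       \<le> C * r powr (-2)" .
  qed
qed

section \<open>The Mittag-Leffler function as a contour integral\<close>

text \<open>
  On the contour, \<open>z \<zeta>\<close> is the \<open>\<rho>\<close>-th root of \<open>u = exp w\<close>. Hence the factor \<open>z\<^sup>k u\<^sup>-\<^sup>k\<^sup>/\<^sup>\<rho>\<close> of the
  \<open>k\<close>-th term is \<open>\<zeta>\<^sup>-\<^sup>k\<close>, and \<open>\<bar>\<zeta>\<bar> \<ge> R > 1\<close> makes the geometric series converge uniformly.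
\<close>
theorem mittag_leffler_contour:
  fixes \<rho> R t \<theta> \<phi>1 \<phi>2 :: real and \<mu> :: complex
  assumes \<rho>: "\<rho> > 0" and t: "t > 0" and R: "R > 1" and \<phi>: "\<phi>1 \<le> \<phi>2"
    and a1: "- (3 * pi / 2) < \<rho> * (\<theta> + \<phi>1)" "\<rho> * (\<theta> + \<phi>1) < - (pi / 2)"
    and a2: "pi / 2 < \<rho> * (\<theta> + \<phi>2)" "\<rho> * (\<theta> + \<phi>2) < 3 * pi / 2"
  defines "w \<equiv> \<lambda>r \<phi>. of_real (\<rho> * ln (t * r)) + \<i> * of_real (\<rho> * (\<theta> + \<phi>))"
    and "\<zeta> \<equiv> \<lambda>r \<phi>. of_real r * cis \<phi>"
  defines "ray \<equiv> \<lambda>r \<phi>. hankel_integrand \<mu> (w r \<phi>) / (2 * of_real pi * \<i>) * (\<rho> / r) / (1 - 1 / \<zeta> r \<phi>)"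
    and "circ \<equiv> \<lambda>\<phi>. hankel_integrand \<mu> (w R \<phi>) / (2 * of_real pi * \<i>) * (\<i> * \<rho>) / (1 - 1 / \<zeta> R \<phi>)"
  shows "(\<lambda>r. ray r \<phi>2 - ray r \<phi>1) integrable_on {R..}" and "circ integrable_on {\<phi>1..\<phi>2}"
    and "mittag_leffler \<rho> \<mu> (of_real t * cis \<theta>) =
      integral {R..} (\<lambda>r. ray r \<phi>2 - ray r \<phi>1) + integral {\<phi>1..\<phi>2} circ"
proof -
  define z where "z = of_real t * cis \<theta>"
  define s where "s k = \<mu> + of_nat k / of_real \<rho>" for k :: nat
  define g where "g r \<phi> = hankel_integrand \<mu> (w r \<phi>) / (2 * of_real pi * \<i>)" for r \<phi>
  define u where "u r \<phi> = 1 / \<zeta> r \<phi>" for r \<phi>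
  have shift: "z ^ k / (2 * of_real pi * \<i>) * hankel_integrand (s k) (w r \<phi>) = g r \<phi> * u r \<phi> ^ k"
    if "r > 0" for k r \<phi>
  proof -
    define v where "v = - (of_real (ln (t * r)) + \<i> * of_real (\<theta> + \<phi>) :: complex)"
    have "exp v = 1 / (of_real (t * r) * cis (\<theta> + \<phi>))"
      using that t unfolding v_def cis_conv_exp exp_minus exp_add
      by (simp add: exp_of_real field_simps)
    then have zv: "z * exp v = u r \<phi>"
      using that t by (simp add: z_def u_def \<zeta>_def cis_mult[symmetric])
    have "hankel_integrand (s k) (w r \<phi>) = hankel_integrand \<mu> (w r \<phi>) * exp (of_nat k * v)"
    proof -
      have "of_nat k / of_real \<rho> * w r \<phi> = - (of_nat k * v)"
        using \<rho> by (simp add: w_def v_def field_simps)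
      then have "(1 - s k) * w r \<phi> = (1 - \<mu>) * w r \<phi> + of_nat k * v"
        by (simp add: s_def algebra_simps)
      then show ?thesis
        by (simp add: hankel_integrand_def exp_add[symmetric] add.assoc)
    qed
    then show ?thesis
      by (simp add: g_def zv[symmetric] exp_of_nat_mult power_mult_distrib)
  qed
  have "\<exists>F. \<forall>w. (F has_field_derivative hankel_integrand (s k) w) (at w)" for k
    using hankel_integrand_primitive by metis
  then obtain F where F: "\<And>k w. (F k has_field_derivative hankel_integrand (s k) w) (at w)" by metis
  define c where "c k = z ^ k / (2 * of_real pi * \<i>)" for k
  have shift': "c k * (hankel_integrand (s k) (w r \<phi>) * x) = g r \<phi> * x * u r \<phi> ^ k" if "r > 0" for k r \<phi> x
    using arg_cong[OF shift[OF that, of k \<phi>], of "\<lambda>y. y * x"] unfolding c_def by (simp only: mult_ac)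
  \<comment> \<open>The part of the \<open>k\<close>-th term that comes from the arc; the rays supply the rest.\<close>
  define a where "a k = c k * (F k (w R \<phi>2) - F k (w R \<phi>1))" for k
  \<comment> \<open>The zero summand only fits the arc into the form with two geometric series.\<close>
  have arc_k: "((\<lambda>\<phi>. g R \<phi> * (\<i> * \<rho>) * u R \<phi> ^ k + 0 * 0 ^ k) has_integral a k) {\<phi>1..\<phi>2}" for k
  proof -
    have "((\<lambda>\<phi>. c k * F k (w R \<phi>)) has_vector_derivative g R \<phi> * (\<i> * \<rho>) * u R \<phi> ^ k + 0 * 0 ^ k)
            (at \<phi> within A)" for \<phi> A
    proof -
      have "((\<lambda>\<phi>. w R \<phi>) has_vector_derivative \<i> * \<rho>) (at \<phi> within A)"
        unfolding w_def by (auto intro!: derivative_eq_intros has_vector_derivative_of_real)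
      from has_vector_derivative_mult_right[OF has_field_derivative_along[OF F this], of "c k" k]
      show ?thesis using R by (simp only: shift' mult_zero_left add_0_right)
    qed
    from fundamental_theorem_of_calculus[OF \<phi> this] show ?thesis
      by (simp add: a_def right_diff_distrib)
  qed
  have ray_decay: "\<exists>C. \<forall>r\<ge>R. norm (g r \<phi> * (\<rho> / r)) \<le> C * r powr (-2)"
    if neg: "cos (\<rho> * (\<theta> + \<phi>)) < 0" for \<phi>
  proof -
    obtain C where C: "\<And>r. r \<ge> R \<Longrightarrow> norm (hankel_integrand \<mu> (w r \<phi>) * (\<rho> / r)) \<le> C * r powr (-2)"
      using hankel_ray_decay[OF \<rho> t _ neg, of R \<mu>] R unfolding w_def by auto
    have "norm (g r \<phi> * (\<rho> / r)) \<le> C / (2 * pi) * r powr (-2)" if "r \<ge> R" for r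
      using C[OF that] by (simp add: g_def norm_mult norm_divide field_simps)
    then show ?thesis by blast
  qed
  have "cos (\<rho> * (\<theta> + \<phi>2)) < 0" using a2 by (rule cos_neg_left_half_plane)
  then obtain C2 where C2: "\<And>r. r \<ge> R \<Longrightarrow> norm (g r \<phi>2 * (\<rho> / r)) \<le> C2 * r powr (-2)"
    using ray_decay by blast
  have "cos (\<rho> * (\<theta> + \<phi>1)) < 0" using cos_neg_left_half_plane[of "- (\<rho> * (\<theta> + \<phi>1))"] a1 by (simp add: cos_minus)
  then obtain C1 where C1: "\<And>r. r \<ge> R \<Longrightarrow> norm (g r \<phi>1 * (\<rho> / r)) \<le> C1 * r powr (-2)"
    using ray_decay by blast
  define h where "h r = (C2 + C1) * r powr (-2)" for r
  have h: "h integrable_on {R..}"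
    unfolding h_def using has_integral_powr_to_inf[of "-2" R] R
    by (intro integrable_on_mult_right) (auto simp: integrable_on_def)
  have h_ge: "norm (g r \<phi>2 * (\<rho> / r)) + norm (- (g r \<phi>1 * (\<rho> / r))) \<le> h r" if "r \<ge> R" for r
    using C1[OF that] C2[OF that] unfolding h_def norm_minus_cancel by (simp add: distrib_right)
  have norm_u: "norm (u r \<phi>) \<le> 1 / R" if "r \<ge> R" for r \<phi>
    using that R by (simp add: u_def \<zeta>_def norm_divide norm_mult field_simps)
  have R1: "1 / R < 1" using R by simp
  have ray_k: "((\<lambda>r. g r \<phi>2 * (\<rho> / r) * u r \<phi>2 ^ k + - (g r \<phi>1 * (\<rho> / r)) * u r \<phi>1 ^ k)
       has_integral (z ^ k * rGamma (s k) - a k)) {R..}" for k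
  proof -
    have deriv: "((\<lambda>r. c k * F k (w r \<phi>)) has_vector_derivative g r \<phi> * (\<rho> / r) * u r \<phi> ^ k) (at r)"
      if "r \<ge> R" for r \<phi>
    proof -
      have "((\<lambda>r. \<rho> * ln (t * r)) has_real_derivative \<rho> / r) (at r)"
        using that R t by (auto intro!: derivative_eq_intros)
      from has_vector_derivative_of_real[OF this]
      have "((\<lambda>r. w r \<phi>) has_vector_derivative of_real (\<rho> / r)) (at r)"
        unfolding w_def has_vector_derivative_add_const .
      from has_vector_derivative_mult_right[OF has_field_derivative_along[OF F this], of "c k" k]
      show ?thesis using R that by (simp only: shift')
    qed
    define D where "D r = c k * F k (w r \<phi>2) - c k * F k (w r \<phi>1)" for r
    have lim: "(D \<longlongrightarrow> z ^ k * rGamma (s k)) at_top"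
    proof -
      have "filterlim (\<lambda>r. \<rho> * ln (t * r)) at_top at_top"
        using \<rho> t by real_asymp
      from filterlim_compose[OF hankel_limit[OF F a1 a2] this]
      have "((\<lambda>r. F k (w r \<phi>2) - F k (w r \<phi>1)) \<longlongrightarrow> 2 * of_real pi * \<i> * rGamma (s k)) at_top"
        unfolding w_def by simp
      note lim = tendsto_mult_left[OF this, of "c k"]
      have "c k * (2 * of_real pi * \<i> * rGamma (s k)) = z ^ k * rGamma (s k)"
        by (simp add: c_def field_simps)
      from lim[unfolded this right_diff_distrib] show ?thesis
        unfolding D_def[abs_def] .
    qed
    have "((\<lambda>r. g r \<phi>2 * (\<rho> / r) * u r \<phi>2 ^ k + - (g r \<phi>1 * (\<rho> / r)) * u r \<phi>1 ^ k)
       has_integral (z ^ k * rGamma (s k) - D R)) {R..}"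
    proof (rule has_integral_improper[OF _ _ h lim])
      fix r assume r: "r \<ge> R"
      from has_vector_derivative_diff[OF deriv[OF r, of \<phi>2] deriv[OF r, of \<phi>1]]
      show "(D has_vector_derivative
         g r \<phi>2 * (\<rho> / r) * u r \<phi>2 ^ k + - (g r \<phi>1 * (\<rho> / r)) * u r \<phi>1 ^ k) (at r)"
        unfolding D_def[abs_def] by simp
      have u1: "norm (u r \<phi> ^ k) \<le> 1" for \<phi>
        unfolding norm_power
        by (intro power_le_one norm_ge_zero order_trans[OF norm_u[OF r] less_imp_le[OF R1]])
      have "norm (g r \<phi>2 * (\<rho> / r) * u r \<phi>2 ^ k + - (g r \<phi>1 * (\<rho> / r)) * u r \<phi>1 ^ k)
        \<le> norm (g r \<phi>2 * (\<rho> / r)) * norm (u r \<phi>2 ^ k) + norm (- (g r \<phi>1 * (\<rho> / r))) * norm (u r \<phi>1 ^ k)"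
        unfolding norm_mult[of "_ * _" "_ ^ _", symmetric] norm_mult[of "- _", symmetric] by (rule norm_triangle_ineq)
      also have "\<dots> \<le> norm (g r \<phi>2 * (\<rho> / r)) + norm (- (g r \<phi>1 * (\<rho> / r)))"
        by (intro add_mono mult_left_le u1 norm_ge_zero)
      also note h_ge[OF r]
      finally show "norm (g r \<phi>2 * (\<rho> / r) * u r \<phi>2 ^ k + - (g r \<phi>1 * (\<rho> / r)) * u r \<phi>1 ^ k) \<le> h r" .
    qed
    then show ?thesis by (simp add: D_def a_def right_diff_distrib)
  qed
  have ray_eq: "ray r \<phi>2 - ray r \<phi>1
      = g r \<phi>2 * (\<rho> / r) / (1 - u r \<phi>2) + - (g r \<phi>1 * (\<rho> / r)) / (1 - u r \<phi>1)" for r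
    unfolding ray_def g_def u_def by simp
  note rays = geometric_series_integral[OF ray_k norm_u norm_u R1 h h_ge, folded ray_eq]
  show int_ray: "(\<lambda>r. ray r \<phi>2 - ray r \<phi>1) integrable_on {R..}"
    by (rule rays) auto
  have arc_eq: "circ \<phi> = g R \<phi> * (\<i> * \<rho>) / (1 - u R \<phi>) + 0 / (1 - 0)" for \<phi>
    unfolding circ_def g_def u_def by simp
  have "(\<lambda>\<phi>. norm (g R \<phi> * (\<i> * \<rho>)) + norm (0::complex)) integrable_on {\<phi>1..\<phi>2}"
    unfolding g_def w_def by (intro integrable_continuous_interval continuous_intros) auto
  note arcs = geometric_series_integral[OF arc_k _ _ R1 this order_refl, folded arc_eq]
  have norm_u': "norm (u R \<phi>) \<le> 1 / R" "norm (0::complex) \<le> 1 / R" for \<phi>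
    using norm_u[of R \<phi>] R by auto
  have "(\<lambda>\<phi>. circ \<phi>) integrable_on {\<phi>1..\<phi>2}"
    by (rule arcs(1)) (rule norm_u')+
  then show int_arc: "circ integrable_on {\<phi>1..\<phi>2}" .
  have "(\<lambda>k. z ^ k * rGamma (s k) - a k) sums integral {R..} (\<lambda>r. ray r \<phi>2 - ray r \<phi>1)"
    by (rule rays(2)) auto
  moreover have "a sums integral {\<phi>1..\<phi>2} (\<lambda>\<phi>. circ \<phi>)"
    by (rule arcs(2)) (rule norm_u')+
  ultimately have "(\<lambda>k. (z ^ k * rGamma (s k) - a k) + a k) sums
      (integral {R..} (\<lambda>r. ray r \<phi>2 - ray r \<phi>1) + integral {\<phi>1..\<phi>2} (\<lambda>\<phi>. circ \<phi>))"
    by (rule sums_add)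
  then show "mittag_leffler \<rho> \<mu> (of_real t * cis \<theta>) =
      integral {R..} (\<lambda>r. ray r \<phi>2 - ray r \<phi>1) + integral {\<phi>1..\<phi>2} circ"
    unfolding mittag_leffler_def z_def[symmetric] s_def by (simp add: sums_iff)
qed

section \<open>Real and imaginary parts of the integrands\<close>

lemma hankel_integrand_polar:
  assumes "t > 0" "r > 0"
  shows "hankel_integrand \<mu> (of_real (\<rho> * ln (t * r)) + \<i> * of_real (\<rho> * (\<theta> + \<phi>)))
     = of_real ((t * r) powr (\<rho> * (1 - Re \<mu>)) * f_ML \<rho> \<mu> r \<phi> t \<theta>) * cis (xi_ML \<rho> \<mu> r \<phi> t \<theta>)"
proof -
  define L \<beta> where "L = ln (t * r)" and "\<beta> = \<rho> * (\<theta> + \<phi>)"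
  have powr: "(t * r) powr a = exp (a * L)" for a
    using assms by (simp add: powr_def L_def)
  have "exp (of_real (\<rho> * L) + \<i> * of_real \<beta>) + (1 - \<mu>) * (of_real (\<rho> * L) + \<i> * of_real \<beta>)
      = of_real (\<rho> * (1 - Re \<mu>) * L + (exp (\<rho> * L) * cos \<beta> + Im \<mu> * \<beta>))
        + \<i> * of_real (exp (\<rho> * L) * sin \<beta> + (1 - Re \<mu>) * \<beta> - \<rho> * Im \<mu> * L)"
    by (simp add: complex_eq_iff Re_exp Im_exp algebra_simps)
  note exponent = this
  have "hankel_integrand \<mu> (of_real (\<rho> * L) + \<i> * of_real \<beta>)
      = of_real (exp (\<rho> * (1 - Re \<mu>) * L) * exp (exp (\<rho> * L) * cos \<beta> + Im \<mu> * \<beta>))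
        * cis (exp (\<rho> * L) * sin \<beta> + (1 - Re \<mu>) * \<beta> - \<rho> * Im \<mu> * L)"
    unfolding hankel_integrand_def exponent by (simp only: exp_add exp_of_real cis_conv_exp)
  then show ?thesis
    unfolding f_ML_def xi_ML_def powr L_def \<beta>_def by (simp only: mult_ac)
qed

lemma cis_kernel_denominator:
  fixes r \<psi> :: real
  assumes "r > 1"
  shows "r\<^sup>2 + 2 * r * cos \<psi> + 1 > 0" and "r\<^sup>2 - 2 * r * cos \<psi> + 1 > 0"
proof -
  have "\<bar>r * cos \<psi>\<bar> \<le> r" using assms by (simp add: abs_mult mult_left_le)
  moreover have "(r - 1)\<^sup>2 > 0" using assms by simp
  ultimately show "r\<^sup>2 + 2 * r * cos \<psi> + 1 > 0" "r\<^sup>2 - 2 * r * cos \<psi> + 1 > 0"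
    by (auto simp: power2_eq_square algebra_simps abs_le_iff)
qed

lemma cis_kernel:
  assumes "r > 1"
  shows "1 / (1 - 1 / (of_real r * cis \<phi>)) = of_real r * (of_real r - cis \<phi>) / of_real (r\<^sup>2 - 2 * r * cos \<phi> + 1)"
proof -
  have 1: "of_real r * cis \<phi> - 1 \<noteq> 0"
  proof
    assume "of_real r * cis \<phi> - 1 = 0"
    then have "norm (of_real r * cis \<phi>) = 1" by simp
    with assms show False by (simp add: norm_mult)
  qed
  have 2: "complex_of_real (r\<^sup>2 - 2 * r * cos \<phi> + 1) \<noteq> 0"
    using cis_kernel_denominator(2)[OF assms, of \<phi>] unfolding of_real_eq_0_iff by linarith
  have 3: "(of_real r * cis \<phi> - 1) * (of_real r - cis \<phi>) = cis \<phi> * of_real (r\<^sup>2 - 2 * r * cos \<phi> + 1)"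
  proof -
    have "2 * of_real (cos \<phi>) * cis \<phi> = cis \<phi> * cis \<phi> + 1"
      using sin_cos_squared_add[of \<phi>]
      by (simp add: complex_eq_iff power2_eq_square algebra_simps)
    then have "of_real r * (2 * of_real (cos \<phi>) * cis \<phi>) = of_real r * (cis \<phi> * cis \<phi> + 1)" by simp
    then show ?thesis by (simp add: power2_eq_square algebra_simps)
  qed
  have "1 / (1 - 1 / (of_real r * cis \<phi>)) = of_real r * cis \<phi> / (of_real r * cis \<phi> - 1)"
    using assms 1 by (simp add: field_simps)
  also have "\<dots> = of_real r * (of_real r - cis \<phi>) / of_real (r\<^sup>2 - 2 * r * cos \<phi> + 1)"
    unfolding frac_eq_eq[OF 1 2] using arg_cong[OF 3, of "\<lambda>y. of_real r * y"] by (simp only: mult_ac)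
  finally show ?thesis .
qed

lemma circ_integrand_eq:
  assumes "t > 0" "r > 1"
  shows "hankel_integrand \<mu> (of_real (\<rho> * ln (t * r)) + \<i> * of_real (\<rho> * (\<theta> + \<phi>)))
       / (2 * of_real pi * \<i>) * (\<i> * \<rho>) / (1 - 1 / (of_real r * cis \<phi>))
     = Complex (P_Re \<rho> \<mu> r \<phi> t \<theta>) (P_Im \<rho> \<mu> r \<phi> t \<theta>)"
proof -
  have "r > 0" using assms by simp
  define A where "A = (t * r) powr (\<rho> * (1 - Re \<mu>))"
  define f where "f = f_ML \<rho> \<mu> r \<phi> t \<theta>"
  define \<xi> where "\<xi> = xi_ML \<rho> \<mu> r \<phi> t \<theta>"
  define d where "d = r\<^sup>2 - 2 * r * cos \<phi> + 1"
  have "hankel_integrand \<mu> (of_real (\<rho> * ln (t * r)) + \<i> * of_real (\<rho> * (\<theta> + \<phi>)))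
       / (2 * of_real pi * \<i>) * (\<i> * \<rho>) / (1 - 1 / (of_real r * cis \<phi>))
     = of_real (A * f) * cis \<xi> / (2 * of_real pi * \<i>) * (\<i> * \<rho>) * (1 / (1 - 1 / (of_real r * cis \<phi>)))"
    unfolding hankel_integrand_polar[OF \<open>t > 0\<close> \<open>r > 0\<close>] A_def f_def \<xi>_def by simp
  also have "\<dots> = of_real (\<rho> / (2 * pi) * (A * r * f / d)) * (cis \<xi> * (of_real r - cis \<phi>))"
    unfolding cis_kernel[OF assms(2)] d_def[symmetric] by simp
  also have "cis \<xi> * (of_real r - cis \<phi>) = Complex (r * cos \<xi> - cos (\<xi> + \<phi>)) (r * sin \<xi> - sin (\<xi> + \<phi>))"
    by (simp add: right_diff_distrib cis_mult) (simp add: complex_eq_iff)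
  finally show ?thesis
    by (simp add: P_Re_def P_Im_def A_def f_def \<xi>_def d_def complex_eq_iff)
qed

text \<open>
  The rays run in the directions \<open>\<psi> - \<pi>\<close>, which turns the minus signs of the kernel
  \<open>1 / (1 - 1 / \<zeta>)\<close> into the plus signs of \<^const>\<open>K_Re\<close> and \<^const>\<open>K_Im\<close>.
\<close>
lemma ray_integrand_eq:
  assumes "t > 0" "r > 1"
  shows "hankel_integrand \<mu> (of_real (\<rho> * ln (t * r)) + \<i> * of_real (\<rho> * (\<theta> + (\<psi> - pi))))
       / (2 * of_real pi * \<i>) * (\<rho> / r) / (1 - 1 / (of_real r * cis (\<psi> - pi)))
     = of_real (\<rho> / (2 * pi) * ((t * r) powr (\<rho> * (1 - Re \<mu>)) * f_ML \<rho> \<mu> r (\<psi> - pi) t \<theta>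
           / (r\<^sup>2 + 2 * r * cos \<psi> + 1)))
       * Complex (r * sin (xi_ML \<rho> \<mu> r (\<psi> - pi) t \<theta>) + sin (xi_ML \<rho> \<mu> r (\<psi> - pi) t \<theta> + \<psi>))
          (- (r * cos (xi_ML \<rho> \<mu> r (\<psi> - pi) t \<theta>) + cos (xi_ML \<rho> \<mu> r (\<psi> - pi) t \<theta> + \<psi>)))"
proof -
  have "r > 0" using assms by simp
  define A where "A = (t * r) powr (\<rho> * (1 - Re \<mu>))"
  define f where "f = f_ML \<rho> \<mu> r (\<psi> - pi) t \<theta>"
  define \<xi> where "\<xi> = xi_ML \<rho> \<mu> r (\<psi> - pi) t \<theta>"
  define d where "d = r\<^sup>2 + 2 * r * cos \<psi> + 1"
  have frac: "a * f * c / (2 * p * j) * (q / r) * (r * X / e) = q / (2 * p) * (a * f / e) * (c * X / j)"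
    if "r \<noteq> 0" for a f c p j q r X e :: complex
    using that by (simp add: mult_ac)
  have d: "r\<^sup>2 - 2 * r * cos (\<psi> - pi) + 1 = d" by (simp add: d_def cos_diff)
  have cis: "cis (\<psi> - pi) = - cis \<psi>" by (simp add: complex_eq_iff cos_diff sin_diff)
  have "hankel_integrand \<mu> (of_real (\<rho> * ln (t * r)) + \<i> * of_real (\<rho> * (\<theta> + (\<psi> - pi))))
       / (2 * of_real pi * \<i>) * (\<rho> / r) / (1 - 1 / (of_real r * cis (\<psi> - pi)))
     = of_real (A * f) * cis \<xi> / (2 * of_real pi * \<i>) * (\<rho> / r) * (1 / (1 - 1 / (of_real r * cis (\<psi> - pi))))"
    unfolding hankel_integrand_polar[OF \<open>t > 0\<close> \<open>r > 0\<close>] A_def f_def \<xi>_def by simp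
  also have "\<dots> = of_real (\<rho> / (2 * pi) * (A * f / d)) * (cis \<xi> * (of_real r + cis \<psi>) / \<i>)"
    unfolding cis_kernel[OF assms(2)] d unfolding cis minus_minus diff_minus_eq_add of_real_mult of_real_divide of_real_numeral
    by (rule frac) (use \<open>r > 0\<close> in simp)
  also have "cis \<xi> * (of_real r + cis \<psi>) / \<i>
      = Complex (r * sin \<xi> + sin (\<xi> + \<psi>)) (- (r * cos \<xi> + cos (\<xi> + \<psi>)))"
    by (simp add: distrib_left cis_mult) (simp add: complex_eq_iff)
  finally show ?thesis by (simp add: A_def f_def \<xi>_def d_def)
qed

lemma ray_integrand_difference_eq:
  assumes "t > 0" "r > 1"
  shows "hankel_integrand \<mu> (of_real (\<rho> * ln (t * r)) + \<i> * of_real (\<rho> * (\<theta> + (\<psi>2 - pi))))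
       / (2 * of_real pi * \<i>) * (\<rho> / r) / (1 - 1 / (of_real r * cis (\<psi>2 - pi)))
     - hankel_integrand \<mu> (of_real (\<rho> * ln (t * r)) + \<i> * of_real (\<rho> * (\<theta> + (\<psi>1 - pi))))
       / (2 * of_real pi * \<i>) * (\<rho> / r) / (1 - 1 / (of_real r * cis (\<psi>1 - pi)))
     = Complex (K_Re \<rho> \<mu> r \<psi>1 \<psi>2 t \<theta>) (K_Im \<rho> \<mu> r \<psi>1 \<psi>2 t \<theta>)"
proof -
  have frac: "of_real (c * (A * f2 / d2)) * Complex X2 (- Y2) - of_real (c * (A * f1 / d1)) * Complex X1 (- Y1)
      = Complex (c * (A / (d1 * d2)) * (f2 * d1 * X2 - f1 * d2 * X1))
          (c * (A / (d1 * d2)) * (f1 * d2 * Y1 - f2 * d1 * Y2))"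
    if "d1 > 0" "d2 > 0" for c A f1 f2 d1 d2 X1 X2 Y1 Y2 :: real
  proof -
    have e: "A * f2 / d2 = A / (d1 * d2) * (f2 * d1)" "A * f1 / d1 = A / (d1 * d2) * (f1 * d2)"
      using that by auto
    show ?thesis unfolding e using that by (simp add: complex_eq_iff algebra_simps)
  qed
  show ?thesis
    unfolding ray_integrand_eq[OF assms] K_Re_def K_Im_def
    by (rule frac) (rule cis_kernel_denominator(1)[OF assms(2)])+
qed

lemma integral_Complex:
  fixes f g :: "'a::euclidean_space \<Rightarrow> real"
  assumes "(\<lambda>x. Complex (f x) (g x)) integrable_on S"
  shows "f integrable_on S" "g integrable_on S"
    "integral S (\<lambda>x. Complex (f x) (g x)) = of_real (integral S f) + \<i> * of_real (integral S g)"
proof -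
  have "(\<lambda>x. Re (Complex (f x) (g x))) integrable_on S" "(\<lambda>x. Im (Complex (f x) (g x))) integrable_on S"
    using integrable_linear[OF assms bounded_linear_Re] integrable_linear[OF assms bounded_linear_Im]
    by (simp_all add: o_def)
  then show "f integrable_on S" "g integrable_on S" by simp_all
  show "integral S (\<lambda>x. Complex (f x) (g x)) = of_real (integral S f) + \<i> * of_real (integral S g)"
    using integral_linear[OF assms bounded_linear_Re] integral_linear[OF assms bounded_linear_Im]
    by (simp add: o_def complex_eq_iff)
qed

theorem theorem1:
  fixes \<rho> \<epsilon> \<delta>1 \<delta>2 t \<theta> :: real and \<mu> z :: complex
  assumes "\<rho> > 1 / 2" and "\<epsilon> > 0"
    and "pi / (2 * \<rho>) < \<delta>1" and "\<delta>1 \<le> min pi (pi / \<rho>)"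
    and "pi / (2 * \<rho>) < \<delta>2" and "\<delta>2 \<le> min pi (pi / \<rho>)"
    and "z = of_real t * exp (\<i> * of_real \<theta>)" and "t = cmod z" and "t > 0"
    and "pi / (2 * \<rho>) - \<delta>2 + pi < \<theta>" and "\<theta> < - pi / (2 * \<rho>) + \<delta>1 + pi"
  shows "(\<lambda>r. K_Re \<rho> \<mu> r (- \<delta>1) \<delta>2 t \<theta>) integrable_on {1 + \<epsilon>..} \<and>
     (\<lambda>r. K_Im \<rho> \<mu> r (- \<delta>1) \<delta>2 t \<theta>) integrable_on {1 + \<epsilon>..} \<and>
     (\<lambda>\<phi>. P_Re \<rho> \<mu> (1 + \<epsilon>) \<phi> t \<theta>) integrable_on {- \<delta>1 - pi..\<delta>2 - pi} \<and>
     (\<lambda>\<phi>. P_Im \<rho> \<mu> (1 + \<epsilon>) \<phi> t \<theta>) integrable_on {- \<delta>1 - pi..\<delta>2 - pi} \<and>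
     mittag_leffler \<rho> \<mu> z =
      of_real (integral {1 + \<epsilon>..} (\<lambda>r. K_Re \<rho> \<mu> r (- \<delta>1) \<delta>2 t \<theta>))
      + of_real (integral {- \<delta>1 - pi..\<delta>2 - pi} (\<lambda>\<phi>. P_Re \<rho> \<mu> (1 + \<epsilon>) \<phi> t \<theta>))
      + \<i> * (of_real (integral {1 + \<epsilon>..} (\<lambda>r. K_Im \<rho> \<mu> r (- \<delta>1) \<delta>2 t \<theta>))
             + of_real (integral {- \<delta>1 - pi..\<delta>2 - pi} (\<lambda>\<phi>. P_Im \<rho> \<mu> (1 + \<epsilon>) \<phi> t \<theta>)))"
proof -
  have \<rho>: "\<rho> > 0" and R: "1 + \<epsilon> > 1" using assms by auto
  \<comment> \<open>On the two rays the argument of \<open>z \<zeta>\<close> lies in \<open>(-3a, -a)\<close> and \<open>(a, 3a)\<close>: the hypotheses on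
      \<open>\<theta>\<close> give the bounds \<open>\<plusminus>a\<close>, and \<open>\<delta>1, \<delta>2 \<le> 2a\<close> then gives \<open>\<plusminus>3a\<close>.\<close>
  define a where "a = pi / (2 * \<rho>)"
  have \<rho>a: "\<rho> * - (3 * a) = - (3 * pi / 2)" "\<rho> * - a = - (pi / 2)" "\<rho> * a = pi / 2" "\<rho> * (3 * a) = 3 * pi / 2"
    using \<rho> by (simp_all add: a_def)
  have "pi / \<rho> = 2 * a" "a > 0" using \<rho> by (simp_all add: a_def)
  moreover have "a < \<delta>1" "\<delta>1 \<le> pi / \<rho>" "a < \<delta>2" "\<delta>2 \<le> pi / \<rho>" "a - \<delta>2 + pi < \<theta>" "\<theta> < - a + \<delta>1 + pi"
    using assms by (simp_all add: a_def)
  ultimately have ineqs: "- (3 * a) < \<theta> + (- \<delta>1 - pi)" "\<theta> + (- \<delta>1 - pi) < - a"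
    "a < \<theta> + (\<delta>2 - pi)" "\<theta> + (\<delta>2 - pi) < 3 * a" "- \<delta>1 - pi \<le> \<delta>2 - pi"
    by linarith+
  note angles = ineqs(1-4)[THEN mult_strict_left_mono[OF _ \<rho>], unfolded \<rho>a]
  note contour = mittag_leffler_contour[OF \<rho> \<open>t > 0\<close> R ineqs(5) angles, where \<mu> = \<mu>]
  have rays: "(\<lambda>r. Complex (K_Re \<rho> \<mu> r (- \<delta>1) \<delta>2 t \<theta>) (K_Im \<rho> \<mu> r (- \<delta>1) \<delta>2 t \<theta>))
      integrable_on {1 + \<epsilon>..}"
    using contour(1)
    by (rule integrable_eq, intro ray_integrand_difference_eq \<open>t > 0\<close>) (use R in auto)
  have circ: "(\<lambda>\<phi>. Complex (P_Re \<rho> \<mu> (1 + \<epsilon>) \<phi> t \<theta>) (P_Im \<rho> \<mu> (1 + \<epsilon>) \<phi> t \<theta>))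
      integrable_on {- \<delta>1 - pi..\<delta>2 - pi}"
    using contour(2) unfolding circ_integrand_eq[OF \<open>t > 0\<close> R] .
  have "mittag_leffler \<rho> \<mu> z =
     integral {1 + \<epsilon>..} (\<lambda>r. Complex (K_Re \<rho> \<mu> r (- \<delta>1) \<delta>2 t \<theta>) (K_Im \<rho> \<mu> r (- \<delta>1) \<delta>2 t \<theta>))
     + integral {- \<delta>1 - pi..\<delta>2 - pi}
        (\<lambda>\<phi>. Complex (P_Re \<rho> \<mu> (1 + \<epsilon>) \<phi> t \<theta>) (P_Im \<rho> \<mu> (1 + \<epsilon>) \<phi> t \<theta>))"
    unfolding assms(7) cis_conv_exp[symmetric] contour(3) circ_integrand_eq[OF \<open>t > 0\<close> R]
    by (intro arg_cong2[where f = "(+)"] refl integral_cong ray_integrand_difference_eq \<open>t > 0\<close>)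
       (use R in auto)
  with integral_Complex[OF rays] integral_Complex[OF circ] show ?thesis
    by (simp add: distrib_left)
qed

end
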